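(* Let $S_m$ be the star with $m\ge1$ edges. Then \[ \mathrm{vol}(\mathscr{Q}(S_m))=\frac{\mathrm{vol}(\mathscr{O}(S_m))}{2^m}=\frac{(m!)^2}{(2m+1)!}, \] volumes being taken in $\mathbb{R}^{2m+1}$.
   Context: The star $S_m$ has vertices $0,\dots,m$ and edges $(0,k)$, $k=1,\dots,m$. For a graph $G=(V,E)$, polytopes live in $\mathbb{R}^{|V|+|E|}$ with coordinates $x_i$ ($i\in V$), $y_{ij}$ ($(i,j)\in E$). $\mathscr{Q}(G)$: points with all coordinates in $[0,1]$ satisfying for each edge $(i,j)$: $y_{ij}\ge0$, $y_{ij}\le x_i$, $y_{ij}\le x_j$, $x_i+x_j\le1+y_{ij}$. $\mathscr{O}(G)$: points with all coordinates in $[0,1]$ satisfying $y_{ij}\le x_i$, $y_{ij}\le x_j$ for each edge. *)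

theory Defs
  imports "HOL-Analysis.Analysis"
begin

text \<open>A finite simple graph is a pair \<open>(V, E)\<close>; an edge is the unordered pair \<open>{i, j}\<close> of its
  end points.\<close>

type_synonym 'a graph = "'a set \<times> 'a set set"

definition star :: "nat \<Rightarrow> nat graph" where
  "star m = ({0..m}, (\<lambda>k. {0, k}) ` {1..m})"

text \<open>Points of $\mathbb{R}^{|V|+|E|}$ are the real functions on the disjoint sum \<open>V <+> E\<close>
  (extensional, i.e. \<open>undefined\<close> outside it): \<open>z (Inl i)\<close> is the coordinate $x_i$ and
  \<open>z (Inr {i, j})\<close> is the coordinate $y_{ij}$.\<close>

definition coords :: "'a graph \<Rightarrow> ('a + 'a set) set" where
  "coords G = fst G <+> snd G"

definition Q_polytope :: "'a graph \<Rightarrow> ('a + 'a set \<Rightarrow> real) set" where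
  "Q_polytope G = {z \<in> coords G \<rightarrow>\<^sub>E {0..1}.
     \<forall>i j. {i, j} \<in> snd G \<longrightarrow>
       0 \<le> z (Inr {i, j}) \<and>
       z (Inr {i, j}) \<le> z (Inl i) \<and>
       z (Inr {i, j}) \<le> z (Inl j) \<and>
       z (Inl i) + z (Inl j) \<le> 1 + z (Inr {i, j})}"

definition O_polytope :: "'a graph \<Rightarrow> ('a + 'a set \<Rightarrow> real) set" where
  "O_polytope G = {z \<in> coords G \<rightarrow>\<^sub>E {0..1}.
     \<forall>i j. {i, j} \<in> snd G \<longrightarrow>
       z (Inr {i, j}) \<le> z (Inl i) \<and>
       z (Inr {i, j}) \<le> z (Inl j)}"

text \<open>Lebesgue volume in the coordinate space of \<open>G\<close>.\<close>

definition vol :: "'a graph \<Rightarrow> ('a + 'a set \<Rightarrow> real) set \<Rightarrow> real" where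
  "vol G S = measure (Pi\<^sub>M (coords G) (\<lambda>_. lborel)) S"

lemma finite_coords_star: "finite (coords (star m))"
  by (simp add: coords_def star_def)

lemma card_coords_star: "card (coords (star m)) = 2 * m + 1"
proof -
  have "inj_on (\<lambda>k. {0, k}) {1..m}"
    by (auto simp: inj_on_def doubleton_eq_iff)
  then show ?thesis
    by (simp add: coords_def star_def card_Plus card_image)
qed

lemma polytopes_measurable:
  assumes fin: "finite (coords G)" and ends: "\<Union> (snd G) \<subseteq> fst G"
  shows "Q_polytope G \<in> sets (Pi\<^sub>M (coords G) (\<lambda>_. lborel))"
    and "O_polytope G \<in> sets (Pi\<^sub>M (coords G) (\<lambda>_. lborel))"
proof -
  let ?M = "Pi\<^sub>M (coords G) (\<lambda>_. lborel :: real measure)"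
  let ?P = "{p \<in> fst G \<times> fst G. {fst p, snd p} \<in> snd G}"
  have "finite (fst G)"
    using fin by (simp add: coords_def finite_Plus_iff)
  then have finP: "finite ?P" by simp
  have ends': "i \<in> fst G" "j \<in> fst G" if "{i, j} \<in> snd G" for i j
    using ends that by auto
  have m: "(\<lambda>z. z c) \<in> borel_measurable ?M" if "c \<in> coords G" for c
    using measurable_component_singleton[OF that, of "\<lambda>_. lborel :: real measure"] by simp
  have box: "(coords G \<rightarrow>\<^sub>E {0..1}) = {z \<in> space ?M. \<forall>c\<in>coords G. 0 \<le> z c \<and> z c \<le> 1}"
    by (auto simp: space_PiM PiE_iff extensional_def)
  have "{z \<in> space ?M. 0 \<le> z c \<and> z c \<le> 1} \<in> sets ?M" if "c \<in> coords G" for c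
    by (intro sets.sets_Collect_conj borel_measurable_le borel_measurable_const m that)
  then have boxm: "{z \<in> space ?M. \<forall>c\<in>coords G. 0 \<le> z c \<and> z c \<le> 1} \<in> sets ?M"
    using fin by (intro sets.sets_Collect_finite_All) auto
  have edge: "{z \<in> space ?M. 0 \<le> z (Inr {fst p, snd p}) \<and>
       z (Inr {fst p, snd p}) \<le> z (Inl (fst p)) \<and>
       z (Inr {fst p, snd p}) \<le> z (Inl (snd p)) \<and>
       z (Inl (fst p)) + z (Inl (snd p)) \<le> 1 + z (Inr {fst p, snd p})} \<in> sets ?M" (is "?A p \<in> _")
    "{z \<in> space ?M. z (Inr {fst p, snd p}) \<le> z (Inl (fst p)) \<and>
       z (Inr {fst p, snd p}) \<le> z (Inl (snd p))} \<in> sets ?M" (is "?B p \<in> _")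
    if p: "p \<in> ?P" for p
  proof -
    have c: "Inl (fst p) \<in> coords G" "Inl (snd p) \<in> coords G" "Inr {fst p, snd p} \<in> coords G"
      using p by (auto simp: coords_def)
    note f = m[OF c(1)] m[OF c(2)] m[OF c(3)]
    show "?A p \<in> sets ?M"
      by (intro sets.sets_Collect_conj borel_measurable_le borel_measurable_add
            borel_measurable_const f)
    show "?B p \<in> sets ?M"
      by (intro sets.sets_Collect_conj borel_measurable_le f)
  qed
  have "Q_polytope G = {z \<in> space ?M. (\<forall>c\<in>coords G. 0 \<le> z c \<and> z c \<le> 1) \<and>
     (\<forall>p\<in>?P. 0 \<le> z (Inr {fst p, snd p}) \<and>
       z (Inr {fst p, snd p}) \<le> z (Inl (fst p)) \<and>
       z (Inr {fst p, snd p}) \<le> z (Inl (snd p)) \<and>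
       z (Inl (fst p)) + z (Inl (snd p)) \<le> 1 + z (Inr {fst p, snd p}))}"
    unfolding Q_polytope_def box by (auto dest: ends')
  also have "\<dots> \<in> sets ?M"
    by (intro sets.sets_Collect_conj boxm sets.sets_Collect_finite_All edge(1) finP)
  finally show "Q_polytope G \<in> sets ?M" .
  have "O_polytope G = {z \<in> space ?M. (\<forall>c\<in>coords G. 0 \<le> z c \<and> z c \<le> 1) \<and>
     (\<forall>p\<in>?P. z (Inr {fst p, snd p}) \<le> z (Inl (fst p)) \<and>
       z (Inr {fst p, snd p}) \<le> z (Inl (snd p)))}"
    unfolding O_polytope_def box by (auto dest: ends')
  also have "\<dots> \<in> sets ?M"
    by (intro sets.sets_Collect_conj boxm sets.sets_Collect_finite_All edge(2) finP)
  finally show "O_polytope G \<in> sets ?M" .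
qed

end

theory Submission imports Defs begin

text \<open>For a fixed value \<open>t\<close> of the hub coordinate, the coordinate pairs of the \<open>m\<close> edges range
  independently over a planar section, so the volume is the integral over \<open>[0, 1]\<close> of the \<open>m\<close>-th
  power of the section's area. That area is \<open>t (1 - t)\<close> for \<open>\<Q>\<close> and \<open>t (2 - t) / 2\<close> for \<open>\<O>\<close>.
  The first integral is a Beta value; the second reduces to it by \<open>t = 2 u\<close>, because
  \<open>u (1 - u)\<close> is symmetric about \<open>1/2\<close>.\<close>

section \<open>Iterated integration over the star\<close>

lemma coords_star_Suc:
  "coords (star (Suc m)) = insert (Inr {0, Suc m}) (insert (Inl (Suc m)) (coords (star m)))"
  by (auto simp: coords_def star_def atLeastAtMostSuc_conv)

lemma Inl_in_coords_star [simp]: "Inl i \<in> coords (star m) \<longleftrightarrow> i \<le> m"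
  by (auto simp: coords_def star_def)

lemma Inr_in_coords_star [simp]: "Inr {0, k} \<in> coords (star m) \<longleftrightarrow> 1 \<le> k \<and> k \<le> m"
  by (auto simp: coords_def star_def doubleton_eq_iff)

text \<open>The weight \<open>f\<close> is what makes the induction on \<open>m\<close> go through: integrating out the last edge
  turns it into \<open>f\<close> times the area of the section.\<close>

lemma nn_integral_star:
  fixes f :: "real \<Rightarrow> ennreal" and g :: "real \<Rightarrow> real \<Rightarrow> real \<Rightarrow> ennreal"
  assumes g: "(\<lambda>(t, x, y). g t x y) \<in> borel_measurable borel"
    and f: "f \<in> borel_measurable borel"
  shows "(\<integral>\<^sup>+ z. f (z (Inl 0)) * (\<Prod>k\<in>{1..m}. g (z (Inl 0)) (z (Inl k)) (z (Inr {0, k})))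
            \<partial>Pi\<^sub>M (coords (star m)) (\<lambda>_. lborel)) =
         (\<integral>\<^sup>+ t. f t * (\<integral>\<^sup>+ x. \<integral>\<^sup>+ y. g t x y \<partial>lborel \<partial>lborel) ^ m \<partial>lborel)"
  using f
proof (induction m arbitrary: f)
  interpret product_sigma_finite "\<lambda>_ :: nat + nat set. lborel :: real measure" ..
  case 0
  have "coords (star 0) = {Inl 0}"
    by (auto simp: coords_def star_def)
  then show ?case
    using 0 product_nn_integral_singleton[of f "Inl 0"] by simp
next
  interpret product_sigma_finite "\<lambda>_ :: nat + nat set. lborel :: real measure" ..
  case (Suc m)
  note [measurable] = Suc.prems
  have g' [measurable]: "(\<lambda>p. g (fst p) (fst (snd p)) (snd (snd p))) \<in>
      borel_measurable (borel \<Otimes>\<^sub>M borel \<Otimes>\<^sub>M borel)"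
    using g by (simp add: borel_prod case_prod_unfold)
  \<comment> \<open>The hypothesis on \<open>g\<close> concerns triples. The curried form lets each
    argument be any measurable function, such as a coordinate of a point.\<close>
  have gm [measurable (raw)]: "(\<lambda>w. g (a w) (b w) (c w)) \<in> borel_measurable N"
    if [measurable]: "a \<in> borel_measurable N" "b \<in> borel_measurable N" "c \<in> borel_measurable N"
    for a b c and N :: "'z measure"
    using measurable_compose[of "\<lambda>w. (a w, b w, c w)" N, OF _ g'] by simp
  let ?C = "coords (star m)" and ?a = "\<lambda>t. \<integral>\<^sup>+ x. \<integral>\<^sup>+ y. g t x y \<partial>lborel \<partial>lborel"
  let ?P = "\<lambda>z. \<Prod>k\<in>{1..m}. g (z (Inl 0)) (z (Inl k)) (z (Inr {0, k}))"
  let ?b = "\<lambda>t x. \<integral>\<^sup>+ y. g t x y \<partial>lborel"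
  \<comment> \<open>\<open>?F\<close> is the integrand for \<open>Suc m\<close> with the factor of
    the new edge split off, and \<open>?H\<close> is what remains once \<open>y\<close> is
    integrated out. Peeling off the edge coordinate before the leaf coordinate matches the nesting
    of the integrals in \<open>?a\<close>.\<close>
  let ?F = "\<lambda>z. f (z (Inl 0)) * (?P z * g (z (Inl 0)) (z (Inl (Suc m))) (z (Inr {0, Suc m})))"
  let ?H = "\<lambda>z. f (z (Inl 0)) * (?P z * ?b (z (Inl 0)) (z (Inl (Suc m))))"
  \<comment> \<open>The factors of \<open>?P\<close> have \<open>k \<le> m\<close>, so they do not
    see the two new coordinates.\<close>
  have P_upd: "?P (z(Inr {0, Suc m} := y)) = ?P z" "?P (z(Inl (Suc m) := x)) = ?P z" for z x y
    by (auto simp: doubleton_eq_iff intro!: prod.cong)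
  have fin: "finite ?C" "finite (insert (Inl (Suc m)) ?C)"
    by (simp_all add: finite_coords_star)
  have m [measurable (raw)]: "(\<lambda>z. z c) \<in> borel_measurable (Pi\<^sub>M D (\<lambda>_. lborel :: real measure))"
    if "c \<in> D" for c and D :: "(nat + nat set) set"
    using measurable_component_singleton[OF that, of "\<lambda>_. lborel :: real measure"] by simp
  have bm [measurable (raw)]: "(\<lambda>w. ?b (a w) (b w)) \<in> borel_measurable N"
    if [measurable]: "a \<in> borel_measurable N" "b \<in> borel_measurable N"
    for a b and N :: "'z measure"
    by measurable
  have Pm: "?P \<in> borel_measurable (Pi\<^sub>M D (\<lambda>_. lborel :: real measure))"
    if "?C \<subseteq> D" for D :: "(nat + nat set) set"
    by (intro borel_measurable_prod_ennreal gm m subsetD[OF that]) auto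
  have Fm: "?F \<in> borel_measurable (Pi\<^sub>M (coords (star (Suc m))) (\<lambda>_. lborel))"
    by (intro borel_measurable_times_ennreal measurable_compose[OF m Suc.prems] Pm gm m)
      (auto simp: coords_star_Suc)
  have Hm: "?H \<in> borel_measurable (Pi\<^sub>M (insert (Inl (Suc m)) ?C) (\<lambda>_. lborel))"
    by (intro borel_measurable_times_ennreal measurable_compose[OF m Suc.prems] Pm bm m) auto
  have am [measurable]: "?a \<in> borel_measurable borel"
    by measurable
  have "(\<integral>\<^sup>+ z. ?F z \<partial>Pi\<^sub>M (coords (star (Suc m))) (\<lambda>_. lborel)) =
      (\<integral>\<^sup>+ z. \<integral>\<^sup>+ y. ?F (z(Inr {0, Suc m} := y)) \<partial>lborel
        \<partial>Pi\<^sub>M (insert (Inl (Suc m)) ?C) (\<lambda>_. lborel))"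
    using Fm fin unfolding coords_star_Suc by (subst product_nn_integral_insert) auto
  also have "\<dots> = (\<integral>\<^sup>+ z. ?H z \<partial>Pi\<^sub>M (insert (Inl (Suc m)) ?C) (\<lambda>_. lborel))"
    unfolding P_upd by (simp add: nn_integral_cmult)
  also have "\<dots> = (\<integral>\<^sup>+ z. \<integral>\<^sup>+ x. ?H (z(Inl (Suc m) := x)) \<partial>lborel \<partial>Pi\<^sub>M ?C (\<lambda>_. lborel))"
    using Hm fin by (subst product_nn_integral_insert) auto
  also have "\<dots> = (\<integral>\<^sup>+ z. f (z (Inl 0)) * ?a (z (Inl 0)) * ?P z \<partial>Pi\<^sub>M ?C (\<lambda>_. lborel))"
    unfolding P_upd by (simp add: nn_integral_cmult nn_integral_multc mult_ac)
  also have "\<dots> = (\<integral>\<^sup>+ t. f t * ?a t * ?a t ^ m \<partial>lborel)"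
    by (intro Suc.IH[where f = "\<lambda>t. f t * ?a t"]) measurable
  finally show ?case
    by (simp add: mult_ac)
qed

section \<open>Integrals of powers of the section areas\<close>

text \<open>This is the Beta integral with both parameters \<open>m + 1\<close>, its Gamma values
  being factorials.\<close>

lemma has_integral_power_mult_one_minus:
  "((\<lambda>t::real. (t * (1 - t)) ^ m) has_integral (fact m)\<^sup>2 / fact (2 * m + 1)) {0..1}"
proof -
  have "Beta (real m + 1) (real m + 1) = (fact m)\<^sup>2 / fact (2 * m + 1)"
    using Gamma_fact[of m, where 'a = real] Gamma_fact[of "2 * m + 1", where 'a = real]
    by (simp add: Beta_def power2_eq_square add_ac)
  then have "((\<lambda>t. t powr real m * (1 - t) powr real m) has_integral
      (fact m)\<^sup>2 / fact (2 * m + 1)) {0..1}"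
    using has_integral_Beta_real[of "real m + 1" "real m + 1"] by simp
  \<comment> \<open>The two integrands may differ at the end points: for \<open>m = 0\<close>,
    \<open>0 powr 0 = 0\<close> while \<open>0 ^ 0 = 1\<close>.\<close>
  then show ?thesis
    by (rule has_integral_spike_finite[of "{0, 1}", rotated 2])
      (auto simp: powr_realpow power_mult_distrib)
qed

text \<open>With \<open>t = 2 * u\<close> the base becomes twice \<open>u * (1 - u)\<close>, and
  \<open>u\<close> ranges over the left half of the unit interval. By symmetry this half carries
  half of the Beta value, which cancels the 2 from the change of variable and leaves
  \<open>2 ^ m\<close>.\<close>

lemma has_integral_power_mult_two_minus:
  "((\<lambda>t::real. (t * (2 - t) / 2) ^ m) has_integral 2 ^ m * (fact m)\<^sup>2 / fact (2 * m + 1)) {0..1}"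
proof -
  define p :: "real \<Rightarrow> real" where "p = (\<lambda>t. (t * (1 - t)) ^ m)"
  define J where "J = integral {0..1/2} p"
  have J: "(p has_integral J) {0..1/2}"
    unfolding J_def by (intro integrable_integral integrable_continuous_real) 
      (auto simp: p_def intro!: continuous_intros)
  \<comment> \<open>The reflection \<open>x\<close> to \<open>1 - x\<close> is composed of a sign
    change and a shift by 1; it carries the left half of the interval to the right half and fixes
    \<open>p\<close>.\<close>
  have "((\<lambda>x. p (- x)) has_integral J) {-(1/2)..-0}"
    using J by (subst has_integral_reflect_real)
  then have "((\<lambda>x. p (- (1 *\<^sub>R x + -1))) has_integral J) {1/2..1}"
    using has_integral_affinity'[of "\<lambda>x. p (- x)" J "-(1/2)" 0 1 "-1"] by simp
  then have "(p has_integral J) {1/2..1}"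
    by (simp add: p_def mult_ac)
  then have "(p has_integral (J + J)) {0..1}"
    by (intro has_integral_combine[OF _ _ J]) auto
  then have JJ: "J + J = (fact m)\<^sup>2 / fact (2 * m + 1)"
    using has_integral_power_mult_one_minus[of m] unfolding p_def by (rule has_integral_unique)
  have "((\<lambda>x. p (1/2 * x)) has_integral 2 * J) {0..1}"
    using has_integral_affinity'[of p J 0 "1/2" "1/2" 0] J by simp
  then have "((\<lambda>x. 2 ^ m * p (1/2 * x)) has_integral 2 ^ m * (2 * J)) {0..1}"
    by (rule has_integral_mult_right)
  moreover have "2 ^ m * p (1/2 * x) = (x * (2 - x) / 2) ^ m" for x
  proof -
    have "2 ^ m * p (1/2 * x) = (2 * (1/2 * x * (1 - 1/2 * x))) ^ m"
      by (simp only: p_def power_mult_distrib)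
    also have "2 * (1/2 * x * (1 - 1/2 * x)) = x * (2 - x) / 2"
      by (simp add: field_simps)
    finally show ?thesis .
  qed
  ultimately show ?thesis
    using JJ by simp
qed

section \<open>Areas of the planar sections\<close>

text \<open>Squaring smooths the kink at \<open>a\<close>, so this antiderivative serves the
  fundamental theorem of calculus on the whole interval, without splitting it.\<close>

lemma has_real_derivative_max_zero_square:
  "((\<lambda>x::real. (max 0 (x - a))\<^sup>2 / 2) has_real_derivative max 0 (x - a)) (at x within S)"
proof (rule has_field_derivative_at_within)
  let ?f = "\<lambda>x::real. (max 0 (x - a))\<^sup>2 / 2"
  consider "x < a" | "x > a" | "x = a" by linarith
  then show "(?f has_real_derivative max 0 (x - a)) (at x)"
  proof cases
    case 1
    have "((\<lambda>_. 0) has_real_derivative 0) (at x)"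
      by simp
    then have "(?f has_real_derivative 0) (at x)"
      by (rule has_field_derivative_transform_within_open[where S = "{..<a}"]) (use 1 in auto)
    with 1 show ?thesis by simp
  next
    case 2
    have "((\<lambda>x. (x - a)\<^sup>2 / 2) has_real_derivative x - a) (at x)"
      by (auto intro!: derivative_eq_intros)
    then have "(?f has_real_derivative x - a) (at x)"
      by (rule has_field_derivative_transform_within_open[where S = "{a<..}"]) (use 2 in auto)
    with 2 show ?thesis by simp
  next
    case 3
    \<comment> \<open>At the kink the difference quotient equals \<open>max 0 h / 2\<close> for
      nonzero \<open>h\<close>, which tends to 0 from both sides.\<close>
    have "((\<lambda>h. max 0 h / 2) \<longlongrightarrow> max 0 0 / 2) (at (0::real))"
      by (intro tendsto_intros) simp_all
    moreover have "\<forall>\<^sub>F h :: real in at 0. max 0 h / 2 = (max 0 h)\<^sup>2 / 2 / h"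
      by (auto simp: eventually_at_filter max_def power2_eq_square)
    ultimately have "((\<lambda>h::real. (max 0 h)\<^sup>2 / 2 / h) \<longlongrightarrow> max 0 0 / 2) (at 0)"
      by (rule Lim_transform_eventually)
    with 3 show ?thesis by (simp add: DERIV_def)
  qed
qed

lemma has_integral_max_zero:
  fixes a :: real
  assumes "0 \<le> a" "a \<le> 1"
  shows "((\<lambda>x. max 0 (x - a)) has_integral (1 - a)\<^sup>2 / 2) {0..1}"
  using fundamental_theorem_of_calculus[of 0 1 "\<lambda>x. (max 0 (x - a))\<^sup>2 / 2" "\<lambda>x. max 0 (x - a)"]
    has_real_derivative_max_zero_square[of a] assms
  by (simp add: has_real_derivative_iff_has_vector_derivative)

text \<open>Since \<open>min t x = x - max 0 (x - t)\<close>, the area below the minimum is one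
  triangle minus another.\<close>

lemma has_integral_min:
  fixes t :: real
  assumes "0 \<le> t" "t \<le> 1"
  shows "((\<lambda>x. min t x) has_integral t * (2 - t) / 2) {0..1}"
proof -
  have "((\<lambda>x. x - max 0 (x - t)) has_integral 1 / 2 - (1 - t)\<^sup>2 / 2) {0..1}"
    using ident_has_integral[of 0 "1::real"] has_integral_max_zero[OF assms]
    by (intro has_integral_diff) simp_all
  moreover have "(\<lambda>x. x - max 0 (x - t)) = (\<lambda>x. min t x)"
    by (auto simp: fun_eq_iff)
  ultimately show ?thesis
    by (simp add: power2_eq_square field_simps)
qed

section \<open>From section areas to volumes\<close>

text \<open>Both polytopes have this shape and differ only in the bounds \<open>l\<close> and
  \<open>u\<close> on an edge coordinate. The indicator of \<open>S\<close> factors into one term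
  for the hub and one per edge, so the volume becomes an integral over the hub coordinate
  alone.\<close>

lemma vol_star:
  fixes l u :: "real \<Rightarrow> real \<Rightarrow> real"
  assumes S: "S = {z \<in> extensional (coords (star m)). z (Inl 0) \<in> {0..1} \<and>
      (\<forall>k\<in>{1..m}. z (Inl k) \<in> {0..1} \<and>
        z (Inr {0, k}) \<in> {l (z (Inl 0)) (z (Inl k))..u (z (Inl 0)) (z (Inl k))})}"
    and m [measurable]: "(\<lambda>(t, x). l t x) \<in> borel_measurable borel"
      "(\<lambda>(t, x). u t x) \<in> borel_measurable borel"
    and le: "\<And>t x. t \<in> {0..1} \<Longrightarrow> x \<in> {0..1} \<Longrightarrow> l t x \<le> u t x"
    and area: "\<And>t. t \<in> {0..1} \<Longrightarrow> ((\<lambda>x. u t x - l t x) has_integral a t) {0..1}"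
    and int: "((\<lambda>t. a t ^ m) has_integral I) {0..1}"
    and meas: "S \<in> sets (Pi\<^sub>M (coords (star m)) (\<lambda>_. lborel))"
  shows "vol (star m) S = I"
proof -
  \<comment> \<open>\<open>g\<close> is the indicator of the section at hub value \<open>t\<close>.
    The constraint on \<open>t\<close> itself is left to the weight in
    \<open>nn_integral_star\<close>.\<close>
  define g :: "real \<Rightarrow> real \<Rightarrow> real \<Rightarrow> ennreal" where
    "g = (\<lambda>t x y. indicator {0..1} x * indicator {l t x..u t x} y)"
  have a_nonneg: "0 \<le> a t" if "t \<in> {0..1}" for t
    using has_integral_nonneg[OF area[OF that]] le[OF that] by simp
  have l': "(\<lambda>p. l (fst p) (fst (snd p))) \<in> borel_measurable borel"
    and u': "(\<lambda>p. u (fst p) (fst (snd p))) \<in> borel_measurable borel"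
    using measurable_compose[OF _ m(1), of "\<lambda>p. (fst p, fst (snd p))" borel]
      measurable_compose[OF _ m(2), of "\<lambda>p. (fst p, fst (snd p))" borel]
    by (simp_all add: borel_measurable_continuous_onI continuous_intros)
  have "{p. fst (snd p) \<in> {0..1} \<and>
      snd (snd p) \<in> {l (fst p) (fst (snd p))..u (fst p) (fst (snd p))}} \<in> sets borel"
  proof -
    note [measurable] = l' u'
    have [measurable]: "(\<lambda>p. fst (snd p)) \<in> borel_measurable (borel :: (real \<times> real \<times> real) measure)"
      "(\<lambda>p. snd (snd p)) \<in> borel_measurable (borel :: (real \<times> real \<times> real) measure)"
      by (simp_all add: borel_measurable_continuous_onI continuous_intros)
    show ?thesis
      unfolding atLeastAtMost_iff by measurable
  qed
  then have "(\<lambda>p. g (fst p) (fst (snd p)) (snd (snd p))) \<in> borel_measurable borel"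
    by (subst measurable_cong[where g = "indicator {p. fst (snd p) \<in> {0..1} \<and>
        snd (snd p) \<in> {l (fst p) (fst (snd p))..u (fst p) (fst (snd p))}}"])
      (auto simp: g_def indicator_def)
  then have gm: "(\<lambda>(t, x, y). g t x y) \<in> borel_measurable borel"
    by (simp add: case_prod_unfold)
  have "(\<integral>\<^sup>+ y. g t x y \<partial>lborel) = ennreal (u t x - l t x) * indicator {0..1} x"
    if "t \<in> {0..1}" for t x
    using le[OF that, of x] by (cases "x \<in> {0..1}") (simp_all add: g_def)
  then have area': "(\<integral>\<^sup>+ x. \<integral>\<^sup>+ y. g t x y \<partial>lborel \<partial>lborel) = ennreal (a t)"
    if "t \<in> {0..1}" for t
    using nn_integral_has_integral_lebesgue'[OF _ area[OF that]] le[OF that] that by simp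
  have "emeasure (Pi\<^sub>M (coords (star m)) (\<lambda>_. lborel)) S =
      (\<integral>\<^sup>+ z. indicator S z \<partial>Pi\<^sub>M (coords (star m)) (\<lambda>_. lborel))"
    using meas by simp
  also have "\<dots> = (\<integral>\<^sup>+ z. indicator {0..1} (z (Inl 0)) *
      (\<Prod>k\<in>{1..m}. g (z (Inl 0)) (z (Inl k)) (z (Inr {0, k})))
      \<partial>Pi\<^sub>M (coords (star m)) (\<lambda>_. lborel))"
  proof (rule nn_integral_cong)
    fix z :: "nat + nat set \<Rightarrow> real"
    assume "z \<in> space (Pi\<^sub>M (coords (star m)) (\<lambda>_. lborel))"
    then have "z \<in> extensional (coords (star m))"
      by (simp add: space_PiM PiE_iff)
    moreover define R where "R k \<longleftrightarrow> z (Inl k) \<in> {0..1} \<and>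
      z (Inr {0, k}) \<in> {l (z (Inl 0)) (z (Inl k))..u (z (Inl 0)) (z (Inl k))}" for k
    ultimately have "z \<in> S \<longleftrightarrow> z (Inl 0) \<in> {0..1} \<and> (\<forall>k\<in>{1..m}. R k)"
      unfolding S R_def by simp
    moreover have "g (z (Inl 0)) (z (Inl k)) (z (Inr {0, k})) = of_bool (R k)" for k
      by (simp add: g_def R_def indicator_def)
    moreover have "(\<Prod>k\<in>{1..m}. of_bool (R k)) = (of_bool (\<forall>k\<in>{1..m}. R k) :: ennreal)"
      by (cases "\<forall>k\<in>{1..m}. R k") (auto intro: prod.neutral prod_zero)
    ultimately show "indicator S z = indicator {0..1} (z (Inl 0)) *
        (\<Prod>k\<in>{1..m}. g (z (Inl 0)) (z (Inl k)) (z (Inr {0, k})))"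
      by (simp add: indicator_def)
  qed
  also have "\<dots> = (\<integral>\<^sup>+ t. indicator {0..1} t * (\<integral>\<^sup>+ x. \<integral>\<^sup>+ y. g t x y \<partial>lborel \<partial>lborel) ^ m \<partial>lborel)"
    by (intro nn_integral_star gm) simp
  \<comment> \<open>The weight vanishes outside the unit interval, so \<open>area'\<close> is used
    only where it is available.\<close>
  also have "\<dots> = (\<integral>\<^sup>+ t. ennreal (a t ^ m) * indicator {0..1} t \<partial>lborel)"
    by (intro nn_integral_cong) (auto simp: indicator_def area' ennreal_power a_nonneg)
  also have "\<dots> = ennreal I"
    using a_nonneg by (intro nn_integral_has_integral_lebesgue'[OF _ int]) simp
  finally show ?thesis
    using has_integral_nonneg[OF int] a_nonneg by (simp add: vol_def measure_def)
qed

section \<open>The two polytopes of the star\<close>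

text \<open>An edge is an unordered pair, so each one is met as \<open>(0, k)\<close> and as
  \<open>(k, 0)\<close>.\<close>

lemma all_star_edges_iff:
  "(\<forall>i j. {i, j} \<in> snd (star m) \<longrightarrow> R i j) \<longleftrightarrow> (\<forall>k\<in>{1..m}. R 0 k \<and> R k 0)"
  by (auto simp: star_def doubleton_eq_iff)

text \<open>This groups the box constraints by hub and edges, the form that \<open>vol_star\<close>
  expects.\<close>

lemma PiE_coords_star_iff:
  "z \<in> coords (star m) \<rightarrow>\<^sub>E A \<longleftrightarrow> z \<in> extensional (coords (star m)) \<and> z (Inl 0) \<in> A \<and>
    (\<forall>k\<in>{1..m}. z (Inl k) \<in> A \<and> z (Inr {0, k}) \<in> A)"
proof -
  have "coords (star m) = insert (Inl 0) (\<Union>k\<in>{1..m}. {Inl k, Inr {0, k}})"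
    by (auto simp: coords_def star_def)
  then show ?thesis
    by (auto simp: PiE_iff)
qed

lemma ends_star: "\<Union> (snd (star m)) \<subseteq> fst (star m)"
  by (auto simp: star_def)

lemma vol_Q_star: "vol (star m) (Q_polytope (star m)) = (fact m)\<^sup>2 / fact (2 * m + 1)"
proof (rule vol_star)
  show "Q_polytope (star m) = {z \<in> extensional (coords (star m)). z (Inl 0) \<in> {0..1} \<and>
      (\<forall>k\<in>{1..m}. z (Inl k) \<in> {0..1} \<and> z (Inr {0, k}) \<in>
        {max 0 (z (Inl 0) + z (Inl k) - 1)..min (z (Inl 0)) (z (Inl k))})}"
    unfolding Q_polytope_def PiE_coords_star_iff all_star_edges_iff
    by (auto simp: insert_commute diff_le_eq add_ac)
  show "((\<lambda>x. min t x - max 0 (t + x - 1)) has_integral t * (1 - t)) {0..1}"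
    if "t \<in> {0..1}" for t :: real
  proof -
    \<comment> \<open>The lower bound \<open>max 0 (t + x - 1)\<close> removes a right triangle with
      legs \<open>t\<close> from the region below \<open>min t x\<close>.\<close>
    have "((\<lambda>x. min t x - max 0 (x - (1 - t))) has_integral
        t * (2 - t) / 2 - (1 - (1 - t))\<^sup>2 / 2) {0..1}"
      using that by (intro has_integral_diff has_integral_min has_integral_max_zero) auto
    moreover have "t * (2 - t) / 2 - (1 - (1 - t))\<^sup>2 / 2 = t * (1 - t)"
      by (simp add: power2_eq_square field_simps)
    moreover have "x - (1 - t) = t + x - 1" for x
      by simp
    ultimately show ?thesis
      by simp
  qed
  show "Q_polytope (star m) \<in> sets (Pi\<^sub>M (coords (star m)) (\<lambda>_. lborel))"
    by (intro polytopes_measurable finite_coords_star ends_star)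
  show "(\<lambda>(t, x). max 0 (t + x - 1)) \<in> borel_measurable (borel :: (real \<times> real) measure)"
    "(\<lambda>(t, x). min t x) \<in> borel_measurable (borel :: (real \<times> real) measure)"
    unfolding case_prod_unfold by (intro borel_measurable_continuous_onI continuous_intros)+
  show "((\<lambda>t::real. (t * (1 - t)) ^ m) has_integral (fact m)\<^sup>2 / fact (2 * m + 1)) {0..1}"
    by (rule has_integral_power_mult_one_minus)
qed auto

lemma vol_O_star:
  "vol (star m) (O_polytope (star m)) = 2 ^ m * (fact m)\<^sup>2 / fact (2 * m + 1)"
proof (rule vol_star)
  \<comment> \<open>Here the lower bound 0 on an edge coordinate comes from the box.\<close>
  show "O_polytope (star m) = {z \<in> extensional (coords (star m)). z (Inl 0) \<in> {0..1} \<and>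
      (\<forall>k\<in>{1..m}. z (Inl k) \<in> {0..1} \<and> z (Inr {0, k}) \<in> {0..min (z (Inl 0)) (z (Inl k))})}"
    unfolding O_polytope_def PiE_coords_star_iff all_star_edges_iff
    by (auto simp: insert_commute)
  show "((\<lambda>x. min t x - 0) has_integral t * (2 - t) / 2) {0..1}" if "t \<in> {0..1}" for t :: real
    using has_integral_min[of t] that by simp
  show "O_polytope (star m) \<in> sets (Pi\<^sub>M (coords (star m)) (\<lambda>_. lborel))"
    by (intro polytopes_measurable finite_coords_star ends_star)
  show "(\<lambda>(t, x). min t x) \<in> borel_measurable (borel :: (real \<times> real) measure)"
    unfolding case_prod_unfold by (intro borel_measurable_continuous_onI continuous_intros)
  show "(\<lambda>(t, x). 0) \<in> borel_measurable (borel :: (real \<times> real) measure)"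
    by simp
  show "((\<lambda>t::real. (t * (2 - t) / 2) ^ m) has_integral
      2 ^ m * (fact m)\<^sup>2 / fact (2 * m + 1)) {0..1}"
    by (rule has_integral_power_mult_two_minus)
qed auto

theorem theorem7:
  fixes m :: nat
  assumes "m \<ge> 1"
  shows "vol (star m) (Q_polytope (star m)) = vol (star m) (O_polytope (star m)) / 2 ^ m \<and>
         vol (star m) (O_polytope (star m)) / 2 ^ m = (fact m)\<^sup>2 / fact (2 * m + 1)"
  by (simp add: vol_Q_star vol_O_star)

end
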